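(* Let $M$ be the hypertoric variety of a simple cooriented affine arrangement $\mathcal{H}=\{H_1,\ldots,H_n\}$ in $(\mathfrak{t}^d)^*$, and let $A\subseteq\{1,\ldots,n\}$. The fixed point set of the action of $S^1$ on $M_A$ is the union of those toric subvarieties $M_A^B$, $B\subseteq\{1,\ldots,n\}$, such that $$\sum_{i\in A}a_i\in\mathfrak{t}^d_B:=\operatorname{Span}_{j\in B}a_j .$$
   Context: Setup. Let $T^n$ be the compact $n$-torus with Lie algebra $\mathfrak{t}^n\cong\mathbb{R}^n$, standard basis $\varepsilon_1,\ldots,\varepsilon_n$, and dual basis $u_1,\ldots,u_n$ of $(\mathfrak{t}^n)^*$. Let $a_1,\ldots,a_n$ be nonzero primitive integer vectors in $\mathfrak{t}^d\cong\mathbb{R}^d$ (the Lie algebra of a torus $T^d$, with lattice $\mathbb{Z}^d$) spanning $\mathfrak{t}^d$. Let $\beta:\mathfrak{t}^n\to\mathfrak{t}^d$, $\beta(\varepsilon_i)=a_i$, with exponentiated map $\beta:T^n\to T^d$ and dual $\beta^*:(\mathfrak{t}^d)^*\to(\mathfrak{t}^n)^*$. Put $k=n-d$, $\mathfrak{t}^k=\ker\beta$, $T^k=\ker(\beta:T^n\to T^d)$, $\iota:\mathfrak{t}^k\to\mathfrak{t}^n$ the inclusion, $\iota^*$ its dual. Fix $\alpha\in(\mathfrak{t}^k)^*$ and a lift $\tilde\alpha\in(\mathfrak{t}^n)^*$ with $\iota^*\tilde\alpha=\alpha$. Arrangement. In $(\mathfrak{t}^d)^*$ set $H_i=\{x\mid\langle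 x,a_i\rangle=\langle-\tilde\alpha,\varepsilon_i\rangle\}$, $F_i=\{x\mid\langle x,a_i\rangle\ge\langle-\tilde\alpha,\varepsilon_i\rangle\}$, $G_i=\{x\mid\langle x,a_i\rangle\le\langle-\tilde\alpha,\varepsilon_i\rangle\}$. The arrangement $\mathcal{H}=\{H_i\}$ is simple if every subset of $m$ hyperplanes with nonempty intersection intersects in codimension $m$. Hypertoric variety. $T^n$ acts on $\mathbb{H}^n\cong T^*\mathbb{C}^n=\{(z,w)\mid z,w\in\mathbb{C}^n\}$ by $t(z,w)=(tz,t^{-1}w)$. $T^k$ has hyperkähler moment map $\bar\mu_{\mathrm{HK}}=\bar\mu_{\mathbb{R}}\oplus\bar\mu_{\mathbb{C}}$, $\bar\mu_{\mathbb{R}}(z,w)=\iota^*\big(\tfrac12\sum_i(|z_i|^2-|w_i|^2)u_i\big)$, $\bar\mu_{\mathbb{C}}(z,w)=\iota^*\big(\sum_iz_iw_iu_i\big)$, and $M=\bar\mu_{\mathrm{HK}}^{-1}(\alpha,0)/T^k$ (an orbifold, since $\mathcal{H}$ is simple). $T^d=T^n/T^k$ acts on $M$ with moment maps $\mu_{\mathbb{R}}:M\to(\mathfrak{t}^d)^*$, $\mu_{\mathbb{C}}:M\to(\mathfrak{t}^d_{\mathbb{C}})^*$ determined by $\beta^*\mu_{\mathbb{R}}[z,w]=\tfrac12\sum_i(|z_i|^2-|w_i|^2)u_i-\tilde\alpha$ and $\beta^*\mu_{\mathbb{C}}[z,w]=\sum_iz_iw_iu_i$; $S^1$ acts by $\tau[z,w]=[z,\tau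 w]$. For $A\subseteq\{1,\ldots,n\}$ let $\Delta_A=\big(\bigcap_{i\notin A}F_i\big)\cap\big(\bigcap_{i\in A}G_i\big)$ and $M_A=\mu_{\mathbb{R}}^{-1}(\Delta_A)\cap\mu_{\mathbb{C}}^{-1}(0)$; equivalently, $M_A$ is the set of $[z,w]\in M$ with $z_i=0$ for $i\in A$ and $w_i=0$ for $i\notin A$. For $B\subseteq\{1,\ldots,n\}$ let $M_A^B\subseteq M_A$ be the (possibly empty) toric subvariety defined by $z_i=w_i=0$ for all $i\in B$; it corresponds to the face $\bigcap_{i\in B}H_i\cap\Delta_A$ of $\Delta_A$. *)

theory Defs
  imports "HOL-Analysis.Analysis"
begin

text \<open>
  Vectors in \<open>t^n\<close> and \<open>t^d\<close> are \<open>real^'n\<close> and \<open>real^'d\<close>. Their duals are identified with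
  the same types through the dual bases, so that the pairing is the inner product and \<open>u\<^sub>i\<close>
  is \<open>axis i 1\<close>. Complexified duals are \<open>complex^'n\<close> and \<open>complex^'d\<close>. The torus \<open>T^n\<close> is
  the set of vectors in \<open>complex^'n\<close> with entries of modulus one, and a point \<open>(z, w)\<close> of
  \<open>T*C^n = H^n\<close> is a pair of vectors in \<open>complex^'n\<close>.
\<close>

section \<open>Tori and the map beta\<close>

definition real_vec :: "int ^ 'd \<Rightarrow> real ^ 'd" where
  "real_vec v = (\<chi> j. real_of_int (v $ j))"

definition primitive_vec :: "int ^ 'd \<Rightarrow> bool" where
  "primitive_vec v \<longleftrightarrow> Gcd (range (\<lambda>j. v $ j)) = 1"

definition beta :: "('n::finite \<Rightarrow> int ^ 'd) \<Rightarrow> real ^ 'n \<Rightarrow> real ^ 'd" where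
  "beta a v = (\<Sum>i\<in>UNIV. (v $ i) *\<^sub>R real_vec (a i))"

definition beta_dual :: "('n::finite \<Rightarrow> int ^ 'd::finite) \<Rightarrow> real ^ 'd \<Rightarrow> real ^ 'n" where
  "beta_dual a x = (\<chi> i. x \<bullet> beta a (axis i 1))"

definition beta_dual_C :: "('n::finite \<Rightarrow> int ^ 'd::finite) \<Rightarrow> complex ^ 'd \<Rightarrow> complex ^ 'n" where
  "beta_dual_C a x = (\<chi> i. \<Sum>j\<in>UNIV. x $ j * of_real (beta a (axis i 1) $ j))"

definition torus :: "(complex ^ 'n) set" where
  "torus = {t. \<forall>i. cmod (t $ i) = 1}"

text \<open>The homomorphism \<open>T^n \<rightarrow> T^d\<close> obtained by exponentiating \<^const>\<open>beta\<close>; see \<open>beta_torus_exp\<close>.\<close>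

definition beta_torus :: "('n::finite \<Rightarrow> int ^ 'd) \<Rightarrow> complex ^ 'n \<Rightarrow> complex ^ 'd" where
  "beta_torus a t = (\<chi> j. \<Prod>i\<in>UNIV. (t $ i) powi (a i $ j))"

definition torus_exp :: "real ^ 'n \<Rightarrow> complex ^ 'n" where
  "torus_exp v = (\<chi> i. cis (2 * pi * v $ i))"

lemma beta_torus_exp:
  fixes a :: "'n::finite \<Rightarrow> int ^ 'd" and v :: "real ^ 'n"
  shows "beta_torus a (torus_exp v) = torus_exp (beta a v)"
proof -
  have cis_sum: "cis (\<Sum>i\<in>S. f i) = (\<Prod>i\<in>S. cis (f i))" if "finite S" for S and f :: "'n \<Rightarrow> real"
    using that by (induction S rule: finite_induct) (auto simp: cis_mult[symmetric])
  show ?thesis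
    by (simp add: vec_eq_iff beta_torus_def torus_exp_def beta_def real_vec_def
        cis_power_int sum_distrib_left cis_sum algebra_simps)
qed

lemma torus_eq_range_exp: "torus = range torus_exp"
proof (rule set_eqI, rule iffI)
  fix t :: "complex ^ 'n" assume "t \<in> torus"
  then have "cmod (t $ i) = 1" for i by (simp add: torus_def)
  then have "t $ i = cis (Arg (t $ i))" for i
    using Arg_eq [of "t $ i"] by (metis cis_conv_exp mult_1 norm_zero of_real_1 zero_neq_one)
  then have "t = torus_exp (\<chi> i. Arg (t $ i) / (2 * pi))"
    by (simp add: torus_exp_def vec_eq_iff)
  then show "t \<in> range torus_exp" by blast
qed (auto simp: torus_def torus_exp_def)

definition ker_lie :: "('n::finite \<Rightarrow> int ^ 'd) \<Rightarrow> (real ^ 'n) set" where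
  "ker_lie a = {v. beta a v = 0}"

definition ker_torus :: "('n::finite \<Rightarrow> int ^ 'd) \<Rightarrow> (complex ^ 'n) set" where
  "ker_torus a = {t \<in> torus. beta_torus a t = 1}"

text \<open>
  \<open>t^k\<close> has no distinguished basis, so elements of its dual are kept as functionals that are
  \<^const>\<open>undefined\<close> outside \<^const>\<open>ker_lie\<close>; the map \<open>\<iota>\<^sup>*\<close> is then restriction. The
  complexified dual of \<open>t^k\<close> consists of the real-linear functionals from \<open>t^k\<close> to the complex
  numbers.
\<close>

definition iota_dual :: "('n::finite \<Rightarrow> int ^ 'd) \<Rightarrow> real ^ 'n \<Rightarrow> real ^ 'n \<Rightarrow> real" where
  "iota_dual a x = restrict (\<lambda>v. x \<bullet> v) (ker_lie a)"

definition iota_dual_C :: "('n::finite \<Rightarrow> int ^ 'd) \<Rightarrow> complex ^ 'n \<Rightarrow> real ^ 'n \<Rightarrow> complex" where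
  "iota_dual_C a x = restrict (\<lambda>v. \<Sum>i\<in>UNIV. x $ i * of_real (v $ i)) (ker_lie a)"

lemma iota_dual_eq_iff: "iota_dual a x = iota_dual a y \<longleftrightarrow> (\<forall>v\<in>ker_lie a. x \<bullet> v = y \<bullet> v)"
  unfolding iota_dual_def by (metis restrict_apply' restrict_ext)

lemma iota_dual_C_eq_0_iff: "iota_dual_C a x = iota_dual_C a 0 \<longleftrightarrow>
    (\<forall>v\<in>ker_lie a. (\<Sum>i\<in>UNIV. x $ i * of_real (v $ i)) = 0)"
proof -
  have "iota_dual_C a 0 = restrict (\<lambda>v. 0) (ker_lie a)"
    by (simp add: iota_dual_C_def)
  then show ?thesis
    unfolding iota_dual_C_def by (metis (mono_tags, lifting) restrict_apply' restrict_ext)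
qed


section \<open>The arrangement\<close>

text \<open>The argument \<open>l\<close> is the lift of \<open>\<alpha>\<close> to the dual of \<open>t^n\<close>.\<close>

definition hyperplane :: "('n \<Rightarrow> int ^ 'd::finite) \<Rightarrow> real ^ 'n \<Rightarrow> 'n \<Rightarrow> (real ^ 'd) set" where
  "hyperplane a l i = {x. x \<bullet> real_vec (a i) = - (l $ i)}"

definition half_F :: "('n \<Rightarrow> int ^ 'd::finite) \<Rightarrow> real ^ 'n \<Rightarrow> 'n \<Rightarrow> (real ^ 'd) set" where
  "half_F a l i = {x. x \<bullet> real_vec (a i) \<ge> - (l $ i)}"

definition half_G :: "('n \<Rightarrow> int ^ 'd::finite) \<Rightarrow> real ^ 'n \<Rightarrow> 'n \<Rightarrow> (real ^ 'd) set" where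
  "half_G a l i = {x. x \<bullet> real_vec (a i) \<le> - (l $ i)}"

text \<open>
  The arrangement is an indexed family: two equal hyperplanes with different indices count as
  two, and such an arrangement is not simple.
\<close>

definition simple_arrangement :: "('n \<Rightarrow> int ^ 'd::finite) \<Rightarrow> real ^ 'n \<Rightarrow> bool" where
  "simple_arrangement a l \<longleftrightarrow>
     (\<forall>S. (\<Inter>i\<in>S. hyperplane a l i) \<noteq> {} \<longrightarrow>
        aff_dim (\<Inter>i\<in>S. hyperplane a l i) = int CARD('d) - int (card S))"

definition Delta :: "('n \<Rightarrow> int ^ 'd::finite) \<Rightarrow> real ^ 'n \<Rightarrow> 'n set \<Rightarrow> (real ^ 'd) set" where
  "Delta a l A = (\<Inter>i\<in>-A. half_F a l i) \<inter> (\<Inter>i\<in>A. half_G a l i)"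


section \<open>The hypertoric variety\<close>

type_synonym 'n point = "(complex ^ 'n) \<times> (complex ^ 'n)"

definition torus_act :: "complex ^ 'n \<Rightarrow> 'n point \<Rightarrow> 'n point" where
  "torus_act t = (\<lambda>(z, w). ((\<chi> i. t $ i * z $ i), (\<chi> i. inverse (t $ i) * w $ i)))"

definition moment_R :: "'n point \<Rightarrow> real ^ 'n" where
  "moment_R = (\<lambda>(z, w). \<chi> i. ((cmod (z $ i))\<^sup>2 - (cmod (w $ i))\<^sup>2) / 2)"

definition moment_C :: "'n point \<Rightarrow> complex ^ 'n" where
  "moment_C = (\<lambda>(z, w). \<chi> i. z $ i * w $ i)"

definition level_set ::
  "('n::finite \<Rightarrow> int ^ 'd) \<Rightarrow> (real ^ 'n \<Rightarrow> real) \<Rightarrow> 'n point set" where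
  "level_set a \<alpha> =
     {p. iota_dual a (moment_R p) = \<alpha> \<and> iota_dual_C a (moment_C p) = iota_dual_C a 0}"

definition orbit_rel ::
  "('n::finite \<Rightarrow> int ^ 'd) \<Rightarrow> (real ^ 'n \<Rightarrow> real) \<Rightarrow> ('n point \<times> 'n point) set" where
  "orbit_rel a \<alpha> =
     {(p, q). p \<in> level_set a \<alpha> \<and> q \<in> level_set a \<alpha> \<and> (\<exists>t\<in>ker_torus a. q = torus_act t p)}"

definition hypertoric ::
  "('n::finite \<Rightarrow> int ^ 'd) \<Rightarrow> (real ^ 'n \<Rightarrow> real) \<Rightarrow> 'n point set set" where
  "hypertoric a \<alpha> = level_set a \<alpha> // orbit_rel a \<alpha>"

lemma torus_act_mult: "torus_act s (torus_act t p) = torus_act (s * t) p"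
  by (auto simp: torus_act_def vec_eq_iff split: prod.splits)

lemma ker_torus_1: "1 \<in> ker_torus a"
  by (simp add: ker_torus_def torus_def beta_torus_def vec_eq_iff)

lemma ker_torus_mult: "s \<in> ker_torus a \<Longrightarrow> t \<in> ker_torus a \<Longrightarrow> s * t \<in> ker_torus a"
  by (simp add: ker_torus_def torus_def beta_torus_def vec_eq_iff norm_mult
      power_int_mult_distrib prod.distrib)

lemma ker_torus_inverse: "t \<in> ker_torus a \<Longrightarrow> (\<chi> i. inverse (t $ i)) \<in> ker_torus a"
  by (simp add: ker_torus_def torus_def beta_torus_def vec_eq_iff norm_inverse
      power_int_inverse prod_inversef [unfolded comp_def])

lemma torus_nonzero: "t \<in> torus \<Longrightarrow> t $ i \<noteq> 0"
  by (metis (mono_tags, lifting) mem_Collect_eq norm_zero torus_def zero_neq_one)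

lemma moment_act:
  assumes "t \<in> torus"
  shows "moment_R (torus_act t p) = moment_R p" "moment_C (torus_act t p) = moment_C p"
proof -
  have "cmod (t $ i) = 1" "t $ i \<noteq> 0" for i
    using assms torus_nonzero by (auto simp: torus_def)
  then show "moment_R (torus_act t p) = moment_R p" "moment_C (torus_act t p) = moment_C p"
    by (auto simp: moment_R_def moment_C_def torus_act_def vec_eq_iff norm_mult norm_inverse
        split: prod.splits)
qed

lemma equiv_orbit_rel: "equiv (level_set a \<alpha>) (orbit_rel a \<alpha>)"
proof (rule equivI)
  show "refl_on (level_set a \<alpha>) (orbit_rel a \<alpha>)"
  proof (rule refl_onI)
    fix p assume "p \<in> level_set a \<alpha>"
    moreover have "torus_act 1 p = p"
      by (auto simp: torus_act_def vec_eq_iff split: prod.splits)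
    ultimately show "(p, p) \<in> orbit_rel a \<alpha>"
      using ker_torus_1 [of a] by (auto simp: orbit_rel_def intro!: bexI [of _ 1])
  qed
  show "orbit_rel a \<alpha> \<subseteq> level_set a \<alpha> \<times> level_set a \<alpha>"
    by (auto simp: orbit_rel_def)
  show "sym (orbit_rel a \<alpha>)"
  proof (rule symI)
    fix p q assume "(p, q) \<in> orbit_rel a \<alpha>"
    then obtain t where t: "p \<in> level_set a \<alpha>" "q \<in> level_set a \<alpha>" "t \<in> ker_torus a"
      "q = torus_act t p" by (auto simp: orbit_rel_def)
    have "t $ i \<noteq> 0" for i
      using t(3) by (simp add: ker_torus_def torus_nonzero)
    then have "p = torus_act (\<chi> i. inverse (t $ i)) q"
      by (simp add: t(4) torus_act_def vec_eq_iff case_prod_unfold prod_eq_iff)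
    with t(1,2) ker_torus_inverse [OF t(3)] show "(q, p) \<in> orbit_rel a \<alpha>"
      unfolding orbit_rel_def by blast
  qed
  show "trans (orbit_rel a \<alpha>)"
  proof (rule transI)
    fix p q r assume "(p, q) \<in> orbit_rel a \<alpha>" "(q, r) \<in> orbit_rel a \<alpha>"
    then obtain s t where "p \<in> level_set a \<alpha>" "r \<in> level_set a \<alpha>"
      "s \<in> ker_torus a" "t \<in> ker_torus a" "r = torus_act (t * s) p"
      by (auto simp: orbit_rel_def torus_act_mult)
    then show "(p, r) \<in> orbit_rel a \<alpha>"
      using ker_torus_mult unfolding orbit_rel_def by blast
  qed
qed

lemma orbit_rel_class:
  assumes "p \<in> level_set a \<alpha>"
  shows "orbit_rel a \<alpha> `` {p} = (\<lambda>t. torus_act t p) ` ker_torus a"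
proof -
  have "torus_act t p \<in> level_set a \<alpha>" if "t \<in> ker_torus a" for t
    using assms that by (simp add: level_set_def ker_torus_def moment_act)
  with assms show ?thesis by (auto simp: orbit_rel_def)
qed

text \<open>The residual action \<open>\<tau>[z, w] = [z, \<tau>w]\<close>, where \<open>[z, w]\<close> is a \<open>T^k\<close>-orbit; see \<open>circle_act_class\<close>.\<close>

definition circle_act :: "complex \<Rightarrow> 'n::finite point set \<Rightarrow> 'n point set" where
  "circle_act \<tau> X = (\<lambda>(z, w). (z, (\<chi> i. \<tau> * w $ i))) ` X"

lemma circle_act_class:
  assumes "(z, w) \<in> level_set a \<alpha>" "cmod \<tau> = 1"
  shows "circle_act \<tau> (orbit_rel a \<alpha> `` {(z, w)}) = orbit_rel a \<alpha> `` {(z, (\<chi> i. \<tau> * w $ i))}"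
proof -
  have C: "iota_dual_C a (moment_C (z, (\<chi> i. \<tau> * w $ i))) = iota_dual_C a 0"
  proof -
    have "(\<Sum>i\<in>UNIV. z $ i * w $ i * of_real (v $ i)) = 0" if "v \<in> ker_lie a" for v
      using assms(1) that by (simp add: level_set_def iota_dual_C_eq_0_iff moment_C_def)
    then have "(\<Sum>i\<in>UNIV. z $ i * (\<tau> * w $ i) * of_real (v $ i)) = 0" if "v \<in> ker_lie a" for v
    proof -
      have "(\<Sum>i\<in>UNIV. z $ i * (\<tau> * w $ i) * of_real (v $ i))
        = \<tau> * (\<Sum>i\<in>UNIV. z $ i * w $ i * of_real (v $ i))"
        by (simp add: sum_distrib_left mult_ac)
      then show ?thesis using that \<open>\<And>v. v \<in> ker_lie a \<Longrightarrow> _\<close> by simp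
    qed
    then show ?thesis by (simp add: iota_dual_C_eq_0_iff moment_C_def)
  qed
  have R: "moment_R (z, (\<chi> i. \<tau> * w $ i)) = moment_R (z, w)"
    using assms(2) by (simp add: moment_R_def norm_mult)
  have L: "(z, (\<chi> i. \<tau> * w $ i)) \<in> level_set a \<alpha>"
    using assms(1) C R by (simp add: level_set_def)
  show ?thesis
    unfolding orbit_rel_class [OF assms(1)] orbit_rel_class [OF L] circle_act_def image_image
    by (rule image_cong) (auto simp: torus_act_def mult_ac)
qed

text \<open>The moment maps of \<open>T^d = T^n/T^k\<close>, defined by their images under the dual of \<^const>\<open>beta\<close>.\<close>

definition mu_R :: "('n::finite \<Rightarrow> int ^ 'd::finite) \<Rightarrow> real ^ 'n \<Rightarrow> 'n point set \<Rightarrow> real ^ 'd" where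
  "mu_R a l X = (THE x. \<forall>p\<in>X. beta_dual a x = moment_R p - l)"

definition mu_C :: "('n::finite \<Rightarrow> int ^ 'd::finite) \<Rightarrow> 'n point set \<Rightarrow> complex ^ 'd" where
  "mu_C a X = (THE x. \<forall>p\<in>X. beta_dual_C a x = moment_C p)"

lemma beta_axis: "beta a (axis i 1) = real_vec (a i)"
  by (simp add: beta_def axis_def if_distrib [of "\<lambda>c. c *\<^sub>R _"] cong: if_cong)

lemma beta_dual_adjoint: "beta_dual a x \<bullet> v = x \<bullet> beta a v"
proof -
  have "beta_dual a x \<bullet> v = (\<Sum>i\<in>UNIV. (x \<bullet> real_vec (a i)) * v $ i)"
    by (subst inner_vec_def) (simp add: beta_dual_def beta_axis)
  then show ?thesis
    by (simp add: inner_sum_right beta_def mult_ac)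
qed

lemma class_rep:
  assumes "X \<in> hypertoric a \<alpha>" "p \<in> X"
  shows "X = orbit_rel a \<alpha> `` {p}" "p \<in> level_set a \<alpha>"
proof -
  obtain q where q: "X = orbit_rel a \<alpha> `` {q}"
    using assms(1) by (auto simp: hypertoric_def elim: quotientE)
  then have qp: "(q, p) \<in> orbit_rel a \<alpha>" using assms(2) by simp
  show "X = orbit_rel a \<alpha> `` {p}"
    using equiv_class_eq [OF equiv_orbit_rel qp] q by simp
  show "p \<in> level_set a \<alpha>"
    using qp by (simp add: orbit_rel_def)
qed

lemma range_beta_dual:
  assumes "\<And>v. v \<in> ker_lie a \<Longrightarrow> y \<bullet> v = 0"
  shows "\<exists>x. beta_dual a x = y"
proof -
  have lin: "linear (beta_dual a)"
    by (rule linearI) (auto simp: beta_dual_def vec_eq_iff inner_add_left)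
  obtain u v where uv: "u \<in> span (range (beta_dual a))"
      "\<And>w. w \<in> span (range (beta_dual a)) \<Longrightarrow> orthogonal v w" "y = u + v"
    using orthogonal_subspace_decomp_exists [of "range (beta_dual a)" y] by blast
  have "x \<bullet> beta a v = 0" for x
    using uv(2) [OF span_base, of "beta_dual a x"] beta_dual_adjoint [of a x v]
    by (simp add: orthogonal_def inner_commute)
  then have "v \<in> ker_lie a"
    by (metis (mono_tags) ker_lie_def inner_eq_zero_iff mem_Collect_eq)
  then have "y \<bullet> v = 0" by (rule assms)
  moreover have "u \<bullet> v = 0" using uv(1,2) by (simp add: orthogonal_def inner_commute)
  ultimately have "v = 0" using uv(3) by (simp add: inner_add_left)
  moreover have "span (range (beta_dual a)) = range (beta_dual a)"
    using lin by (simp add: span_eq_iff linear_subspace_image)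
  ultimately have "y \<in> range (beta_dual a)" using uv(1,3) by (metis add.right_neutral)
  then show ?thesis by (metis imageE)
qed

lemma inj_beta_dual:
  assumes "span (range (\<lambda>i. real_vec (a i))) = UNIV" "beta_dual a x = beta_dual a y"
  shows "x = y"
proof -
  have "(x - y) \<bullet> real_vec (a i) = 0" for i
    using assms(2) by (simp add: beta_dual_def beta_axis vec_eq_iff inner_diff_left)
  then have "orthogonal (x - y) b" if "b \<in> range (\<lambda>i. real_vec (a i))" for b
    using that by (auto simp: orthogonal_def)
  then have "orthogonal (x - y) (x - y)"
    using orthogonal_to_span [of "x - y" "range (\<lambda>i. real_vec (a i))" "x - y"] assms(1) by simp
  then show ?thesis by (simp add: orthogonal_def)
qed

lemma beta_dual_mu_R:
  assumes "span (range (\<lambda>i. real_vec (a i))) = UNIV" "iota_dual a l = \<alpha>"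
    "X \<in> hypertoric a \<alpha>" "p \<in> X"
  shows "beta_dual a (mu_R a l X) = moment_R p - l"
proof -
  have X: "X = orbit_rel a \<alpha> `` {p}" and p: "p \<in> level_set a \<alpha>"
    using class_rep [OF assms(3,4)] by auto
  have const: "moment_R q = moment_R p" if "q \<in> X" for q
    using that unfolding X orbit_rel_class [OF p] by (auto simp: ker_torus_def moment_act simp del: split_paired_All)
  have "(moment_R p - l) \<bullet> v = 0" if "v \<in> ker_lie a" for v
    using p that
    by (simp add: level_set_def iota_dual_eq_iff inner_diff_left flip: assms(2))
  then obtain x where x: "beta_dual a x = moment_R p - l"
    using range_beta_dual by blast
  have "\<forall>q\<in>X. beta_dual a (mu_R a l X) = moment_R q - l"
    unfolding mu_R_def
  proof (rule theI)
    show "\<forall>q\<in>X. beta_dual a x = moment_R q - l" using const x by metis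
    show "y = x" if "\<forall>q\<in>X. beta_dual a y = moment_R q - l" for y
      using that assms(4) x inj_beta_dual [OF assms(1), of y x] by metis
  qed
  then show ?thesis using assms(4) by blast
qed

lemma beta_dual_C_iff: "beta_dual_C a x = y \<longleftrightarrow>
    beta_dual a (\<chi> j. Re (x $ j)) = (\<chi> i. Re (y $ i)) \<and>
    beta_dual a (\<chi> j. Im (x $ j)) = (\<chi> i. Im (y $ i))"
  by (auto simp: beta_dual_C_def beta_dual_def vec_eq_iff complex_eq_iff inner_vec_def)

lemma inj_beta_dual_C:
  assumes "span (range (\<lambda>i. real_vec (a i))) = UNIV" "beta_dual_C a x = beta_dual_C a y"
  shows "x = y"
proof -
  have "(\<chi> j. Re (x $ j)) = (\<chi> j. Re (y $ j))" "(\<chi> j. Im (x $ j)) = (\<chi> j. Im (y $ j))"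
    using beta_dual_C_iff [of a x "beta_dual_C a y"] beta_dual_C_iff [of a y "beta_dual_C a y"]
      assms(2) inj_beta_dual [OF assms(1)] by metis+
  then show ?thesis by (simp add: vec_eq_iff complex_eq_iff)
qed

lemma beta_dual_mu_C:
  assumes "span (range (\<lambda>i. real_vec (a i))) = UNIV" "X \<in> hypertoric a \<alpha>" "p \<in> X"
  shows "beta_dual_C a (mu_C a X) = moment_C p"
proof -
  have X: "X = orbit_rel a \<alpha> `` {p}" and p: "p \<in> level_set a \<alpha>"
    using class_rep [OF assms(2,3)] by auto
  have const: "moment_C q = moment_C p" if "q \<in> X" for q
    using that unfolding X orbit_rel_class [OF p] by (auto simp: ker_torus_def moment_act simp del: split_paired_All)
  have "(\<Sum>i\<in>UNIV. moment_C p $ i * of_real (v $ i)) = 0" if "v \<in> ker_lie a" for v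
    using p that by (simp add: level_set_def iota_dual_C_eq_0_iff)
  then have "(\<chi> i. Re (moment_C p $ i)) \<bullet> v = 0" "(\<chi> i. Im (moment_C p $ i)) \<bullet> v = 0"
    if "v \<in> ker_lie a" for v
    using that by (auto simp: complex_eq_iff inner_vec_def)
  then obtain x y where xy: "beta_dual a x = (\<chi> i. Re (moment_C p $ i))"
      "beta_dual a y = (\<chi> i. Im (moment_C p $ i))"
    using range_beta_dual by meson
  define c where "c = (\<chi> j. Complex (x $ j) (y $ j))"
  have c: "beta_dual_C a c = moment_C p"
    unfolding beta_dual_C_iff using xy by (simp add: c_def vec_lambda_eta)
  have "\<forall>q\<in>X. beta_dual_C a (mu_C a X) = moment_C q"
    unfolding mu_C_def
  proof (rule theI)
    show "\<forall>q\<in>X. beta_dual_C a c = moment_C q" using const c by metis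
    show "e = c" if "\<forall>q\<in>X. beta_dual_C a e = moment_C q" for e
      using that c assms(3) inj_beta_dual_C [OF assms(1), of e c] by metis
  qed
  then show ?thesis using assms(3) by blast
qed

definition M_A ::
  "('n::finite \<Rightarrow> int ^ 'd::finite) \<Rightarrow> (real ^ 'n \<Rightarrow> real) \<Rightarrow> real ^ 'n \<Rightarrow> 'n set \<Rightarrow> 'n point set set"
where
  "M_A a \<alpha> l A = {X \<in> hypertoric a \<alpha>. mu_R a l X \<in> Delta a l A \<and> mu_C a X = 0}"

lemma M_A_iff:
  assumes "span (range (\<lambda>i. real_vec (a i))) = UNIV" "iota_dual a l = \<alpha>"
  shows "X \<in> M_A a \<alpha> l A \<longleftrightarrow> X \<in> hypertoric a \<alpha> \<and>
    (\<forall>(z, w)\<in>X. (\<forall>i\<in>A. z $ i = 0) \<and> (\<forall>i\<in>-A. w $ i = 0))"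
proof (cases "X \<in> hypertoric a \<alpha>")
  case True
  have "mu_R a l X \<in> Delta a l A \<and> mu_C a X = 0 \<longleftrightarrow>
      (\<forall>i\<in>A. z $ i = 0) \<and> (\<forall>i\<in>-A. w $ i = 0)" if "(z, w) \<in> X" for z w
  proof -
    have R: "mu_R a l X \<bullet> real_vec (a i) = ((cmod (z $ i))\<^sup>2 - (cmod (w $ i))\<^sup>2) / 2 - l $ i" for i
      using beta_dual_mu_R [OF assms True that]
      by (simp add: beta_dual_def beta_axis moment_R_def vec_eq_iff)
    have C: "beta_dual_C a (mu_C a X) = (\<chi> i. z $ i * w $ i)"
      using beta_dual_mu_C [OF assms(1) True that] by (simp add: moment_C_def)
    have "mu_C a X = 0 \<longleftrightarrow> (\<forall>i. z $ i * w $ i = 0)"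
    proof
      assume "mu_C a X = 0"
      then show "\<forall>i. z $ i * w $ i = 0"
        using C by (simp add: beta_dual_C_def vec_eq_iff)
    next
      assume "\<forall>i. z $ i * w $ i = 0"
      then have "beta_dual_C a (mu_C a X) = beta_dual_C a 0"
        using C by (simp add: beta_dual_C_def vec_eq_iff)
      then show "mu_C a X = 0" by (rule inj_beta_dual_C [OF assms(1)])
    qed
    moreover have "mu_R a l X \<in> Delta a l A \<longleftrightarrow>
        (\<forall>i\<in>-A. cmod (w $ i) \<le> cmod (z $ i)) \<and> (\<forall>i\<in>A. cmod (z $ i) \<le> cmod (w $ i))"
      by (simp add: Delta_def half_F_def half_G_def R)
    moreover have "z $ i * w $ i = 0 \<and> (i \<notin> A \<longrightarrow> cmod (w $ i) \<le> cmod (z $ i)) \<and>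
        (i \<in> A \<longrightarrow> cmod (z $ i) \<le> cmod (w $ i)) \<longleftrightarrow>
        (i \<in> A \<longrightarrow> z $ i = 0) \<and> (i \<notin> A \<longrightarrow> w $ i = 0)" for i
      by (cases "i \<in> A"; cases "z $ i = 0"; cases "w $ i = 0") simp_all
    ultimately show ?thesis
      unfolding Ball_def Compl_iff by metis
  qed
  then have "case_prod (\<lambda>z w. (\<forall>i\<in>A. z $ i = 0) \<and> (\<forall>i\<in>-A. w $ i = 0)) p \<longleftrightarrow>
      mu_R a l X \<in> Delta a l A \<and> mu_C a X = 0" if "p \<in> X" for p
    using that by (cases p) (simp only: prod.case)
  moreover have "X \<noteq> {}"
    using True in_quotient_imp_non_empty [OF equiv_orbit_rel] unfolding hypertoric_def by blast
  ultimately have "(\<forall>(z, w)\<in>X. (\<forall>i\<in>A. z $ i = 0) \<and> (\<forall>i\<in>-A. w $ i = 0)) \<longleftrightarrow>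
      mu_R a l X \<in> Delta a l A \<and> mu_C a X = 0"
    by (metis (no_types, lifting) all_not_in_conv)
  with True show ?thesis unfolding M_A_def mem_Collect_eq by (simp only: simp_thms)
qed (simp add: M_A_def)

definition M_AB ::
  "('n::finite \<Rightarrow> int ^ 'd::finite) \<Rightarrow> (real ^ 'n \<Rightarrow> real) \<Rightarrow> real ^ 'n \<Rightarrow> 'n set \<Rightarrow> 'n set \<Rightarrow>
     'n point set set"
where
  "M_AB a \<alpha> l A B = {X \<in> M_A a \<alpha> l A. \<forall>(z, w)\<in>X. \<forall>i\<in>B. z $ i = 0 \<and> w $ i = 0}"

definition circle_fixed :: "'n::finite point set set \<Rightarrow> 'n point set set" where
  "circle_fixed Y = {X \<in> Y. \<forall>\<tau>. cmod \<tau> = 1 \<longrightarrow> circle_act \<tau> X = X}"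

end

theory Submission
  imports Defs
begin

text \<open>
  Let \<open>X = [z, w]\<close> be a point of \<open>M\<^sub>A\<close> and let \<open>Z\<close> be the set of indices with
  \<open>z\<^sub>i = w\<^sub>i = 0\<close>. Outside \<open>Z\<close> exactly one of \<open>z\<^sub>i\<close>, \<open>w\<^sub>i\<close> is nonzero: \<open>w\<^sub>i\<close> for \<open>i \<in> A\<close> and
  \<open>z\<^sub>i\<close> for \<open>i \<notin> A\<close>. Hence an element \<open>t\<close> of \<open>T^k\<close> undoes the rotation of the fibre
  coordinates by \<open>\<tau>\<close> exactly if, off \<open>Z\<close>, it has the coordinates \<open>\<tau>\<^sup>-\<^sup>1\<close> on \<open>A\<close> and \<open>1\<close>
  elsewhere, and \<open>X\<close> is fixed by the circle exactly if such a \<open>t\<close> exists for every \<open>\<tau>\<close>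
  (\<open>circle_act_eq_iff\<close>).

  The point is to choose these compensating elements along a line in the Lie algebra
  (\<open>compensating_torus_iff_lie\<close>). A vector \<open>v\<close> in \<open>t^k\<close> with coordinates \<open>-1\<close> on \<open>A\<close> and \<open>0\<close>
  elsewhere, off \<open>Z\<close>, clearly yields all of them by exponentiation. Conversely, logarithms of
  compensating elements for the angles \<open>\<theta> \<in> \<real>\<close> have prescribed values off \<open>Z\<close> and under
  \<^const>\<open>beta\<close> up to integers only. There are uncountably many angles and only countably many
  tuples of integers, so two different angles share all of their integers; the difference of their
  logarithms, divided by the difference of the angles, is a \<open>v\<close> as required. Finally, such a \<open>v\<close>
  is nothing but a linear relation expressing \<open>\<Sum>\<^sub>i\<^sub>\<in>\<^sub>A a\<^sub>i\<close> through the \<open>a\<^sub>j\<close> with \<open>j \<in> Z\<close>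
  (\<open>sum_in_span_iff_lie\<close>).

  So \<open>X\<close> is fixed if and only if the sum lies in the span over \<open>Z\<close>. As \<open>X\<close> lies in
  \<open>M\<^sub>A\<^sup>B\<close> if and only if \<open>B \<subseteq> Z\<close>, and spans grow with \<open>B\<close>, this is the claim.
\<close>

section \<open>Linear relations among the normal vectors\<close>

lemma linear_beta: "linear (beta a)"
  by (rule linearI) (simp_all add: beta_def scaleR_add_left sum.distrib scaleR_sum_right)

lemma span_normals_eq:
  fixes a :: "'n::finite \<Rightarrow> int ^ 'd::finite"
  shows "span ((\<lambda>j. real_vec (a j)) ` B) = beta a ` {v. \<forall>i. i \<notin> B \<longrightarrow> v $ i = 0}"
proof
  let ?V = "{v :: real ^ 'n. \<forall>i. i \<notin> B \<longrightarrow> v $ i = 0}"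
  have "subspace ?V" by (auto simp: subspace_def)
  then have "subspace (beta a ` ?V)"
    by (rule linear_subspace_image [OF linear_beta])
  moreover have "real_vec (a j) \<in> beta a ` ?V" if "j \<in> B" for j
    using that by (intro image_eqI [where x = "axis j 1"]) (auto simp: beta_axis, auto simp: axis_def)
  ultimately show "span ((\<lambda>j. real_vec (a j)) ` B) \<subseteq> beta a ` ?V"
    by (intro span_minimal) auto
  show "beta a ` ?V \<subseteq> span ((\<lambda>j. real_vec (a j)) ` B)"
  proof clarify
    fix v :: "real ^ 'n" assume v: "\<forall>i. i \<notin> B \<longrightarrow> v $ i = 0"
    have "v $ i *\<^sub>R real_vec (a i) \<in> span ((\<lambda>j. real_vec (a j)) ` B)" for i
      using v by (cases "i \<in> B") (auto intro: span_scale span_base simp: span_zero)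
    then show "beta a v \<in> span ((\<lambda>j. real_vec (a j)) ` B)"
      unfolding beta_def by (intro span_sum)
  qed
qed

text \<open>
  Subtracting the indicator vector of \<open>A\<close> turns coefficients of an expression for
  \<open>\<Sum>\<^sub>i\<^sub>\<in>\<^sub>A a\<^sub>i\<close> into an element of the kernel of \<^const>\<open>beta\<close>, and adding it goes back.
\<close>

lemma sum_in_span_iff_lie:
  fixes a :: "'n::finite \<Rightarrow> int ^ 'd::finite"
  shows "(\<Sum>i\<in>A. real_vec (a i)) \<in> span ((\<lambda>j. real_vec (a j)) ` B) \<longleftrightarrow>
    (\<exists>v\<in>ker_lie a. \<forall>i. i \<notin> B \<longrightarrow> v $ i = (if i \<in> A then - 1 else 0))"
proof -
  define e :: "real ^ 'n" where "e = (\<chi> i. if i \<in> A then 1 else 0)"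
  have e: "beta a e = (\<Sum>i\<in>A. real_vec (a i))"
    by (simp add: beta_def e_def if_distrib [of "\<lambda>c. c *\<^sub>R _"] sum.If_cases cong: if_cong)
  show ?thesis
    unfolding span_normals_eq e [symmetric]
  proof
    assume "beta a e \<in> beta a ` {v. \<forall>i. i \<notin> B \<longrightarrow> v $ i = 0}"
    then obtain c where c: "beta a e = beta a c" "\<And>i. i \<notin> B \<Longrightarrow> c $ i = 0" by auto
    then show "\<exists>v\<in>ker_lie a. \<forall>i. i \<notin> B \<longrightarrow> v $ i = (if i \<in> A then - 1 else 0)"
      by (intro bexI [where x = "c - e"])
        (auto simp: e_def ker_lie_def linear_diff [OF linear_beta])
  next
    assume "\<exists>v\<in>ker_lie a. \<forall>i. i \<notin> B \<longrightarrow> v $ i = (if i \<in> A then - 1 else 0)"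
    then obtain v where v: "beta a v = 0" "\<And>i. i \<notin> B \<Longrightarrow> v $ i = (if i \<in> A then - 1 else 0)"
      by (auto simp: ker_lie_def)
    show "beta a e \<in> beta a ` {v. \<forall>i. i \<notin> B \<longrightarrow> v $ i = 0}"
      by (rule image_eqI [where x = "v + e"])
        (auto simp: v e_def linear_add [OF linear_beta])
  qed
qed

section \<open>Compensating elements of the torus\<close>

lemma cis_eq_iff_Ints: "cis (2 * pi * x) = cis (2 * pi * y) \<longleftrightarrow> x - y \<in> \<int>"
proof -
  have "cis (2 * pi * x) = cis (2 * pi * y) \<longleftrightarrow> (\<exists>n::int. x = y + of_int n)"
    using sin_cos_eq_iff [of "2 * pi * x" "2 * pi * y"]
    by (auto simp: complex_eq_iff simp flip: distrib_left)
  then show ?thesis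
    by (auto simp: Ints_def algebra_simps)
qed

lemma torus_exp_eq_1_iff: "torus_exp v = 1 \<longleftrightarrow> (\<forall>i. v $ i \<in> \<int>)"
  using cis_eq_iff_Ints [of _ 0] by (simp add: torus_exp_def vec_eq_iff)

text \<open>
  A logarithm \<open>v\<close> of \<open>t\<close> satisfies the equations for \<open>t\<close> only modulo the integer lattices of
  \<open>T^d\<close> and \<open>T^n\<close>. The errors \<open>m\<close> and \<open>k\<close> are kept as functions into the integers, because
  these form a countable type.
\<close>

lemma compensating_log:
  fixes a :: "'n::finite \<Rightarrow> int ^ 'd::finite"
  assumes "t \<in> ker_torus a"
    and "\<And>i. i \<notin> B \<Longrightarrow> t $ i = (if i \<in> A then inverse (cis (2 * pi * \<theta>)) else 1)"
  shows "\<exists>v (m :: 'd \<Rightarrow> int) (k :: 'n \<Rightarrow> int). (\<forall>j. beta a v $ j = of_int (m j)) \<and>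
    (\<forall>i. i \<notin> B \<longrightarrow> v $ i = (if i \<in> A then - \<theta> else 0) + of_int (k i))"
proof -
  obtain v where v: "t = torus_exp v"
    using assms(1) torus_eq_range_exp unfolding ker_torus_def by blast
  have "torus_exp (beta a v) = 1"
    using assms(1) by (simp add: ker_torus_def v beta_torus_exp)
  then have "\<forall>j. \<exists>m. beta a v $ j = of_int m"
    by (auto simp: torus_exp_eq_1_iff elim: Ints_cases)
  moreover have "\<exists>k. i \<notin> B \<longrightarrow> v $ i = (if i \<in> A then - \<theta> else 0) + of_int k" for i
  proof (cases "i \<in> B")
    case False
    have "cis (2 * pi * v $ i) = cis (2 * pi * (if i \<in> A then - \<theta> else 0))"
      using assms(2) [OF False] by (simp add: v torus_exp_def)
    then have "v $ i - (if i \<in> A then - \<theta> else 0) \<in> \<int>"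
      unfolding cis_eq_iff_Ints .
    then show ?thesis by (metis Ints_cases add.commute diff_add_cancel)
  qed simp
  ultimately show ?thesis by metis
qed

text \<open>
  The elements \<open>t\<close> given for different \<open>\<tau>\<close> are unrelated, so they cannot be differentiated in
  \<open>\<tau>\<close> to obtain \<open>v\<close>. Instead \<open>v\<close> is a difference quotient between two angles, chosen by
  counting so that the integer ambiguities of the logarithms cancel.
\<close>

lemma compensating_torus_iff_lie:
  fixes a :: "'n::finite \<Rightarrow> int ^ 'd::finite"
  shows "(\<forall>\<tau>. cmod \<tau> = 1 \<longrightarrow>
      (\<exists>t\<in>ker_torus a. \<forall>i. i \<notin> B \<longrightarrow> t $ i = (if i \<in> A then inverse \<tau> else 1))) \<longleftrightarrow>
    (\<exists>v\<in>ker_lie a. \<forall>i. i \<notin> B \<longrightarrow> v $ i = (if i \<in> A then - 1 else 0))"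
proof
  assume "\<exists>v\<in>ker_lie a. \<forall>i. i \<notin> B \<longrightarrow> v $ i = (if i \<in> A then - 1 else 0)"
  then obtain v where v: "beta a v = 0" "\<And>i. i \<notin> B \<Longrightarrow> v $ i = (if i \<in> A then - 1 else 0)"
    by (auto simp: ker_lie_def)
  show "\<forall>\<tau>. cmod \<tau> = 1 \<longrightarrow>
      (\<exists>t\<in>ker_torus a. \<forall>i. i \<notin> B \<longrightarrow> t $ i = (if i \<in> A then inverse \<tau> else 1))"
  proof (intro allI impI)
    fix \<tau> assume "cmod \<tau> = 1"
    then have "\<tau> = cis (2 * pi * (Arg \<tau> / (2 * pi)))"
      using rcis_cmod_Arg [of \<tau>] by (simp add: rcis_def)
    then obtain \<theta> where \<theta>: "\<tau> = cis (2 * pi * \<theta>)" ..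
    have "beta a (\<theta> *\<^sub>R v) = 0"
      using v(1) by (simp add: linear_scale [OF linear_beta])
    then have "torus_exp (\<theta> *\<^sub>R v) \<in> ker_torus a"
      using torus_eq_range_exp by (auto simp: ker_torus_def beta_torus_exp torus_exp_eq_1_iff)
    then show "\<exists>t\<in>ker_torus a. \<forall>i. i \<notin> B \<longrightarrow> t $ i = (if i \<in> A then inverse \<tau> else 1)"
      by (rule bexI [rotated]) (auto simp: torus_exp_def v(2) \<theta>)
  qed
next
  assume *: "\<forall>\<tau>. cmod \<tau> = 1 \<longrightarrow>
      (\<exists>t\<in>ker_torus a. \<forall>i. i \<notin> B \<longrightarrow> t $ i = (if i \<in> A then inverse \<tau> else 1))"
  have "\<exists>v (m :: 'd \<Rightarrow> int) (k :: 'n \<Rightarrow> int). (\<forall>j. beta a v $ j = of_int (m j)) \<and>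
      (\<forall>i. i \<notin> B \<longrightarrow> v $ i = (if i \<in> A then - \<theta> else 0) + of_int (k i))" for \<theta>
    using * [rule_format, of "cis (2 * pi * \<theta>)"] compensating_log [of _ a B A \<theta>]
    by (simp only: norm_cis) metis
  then obtain v and m :: "real \<Rightarrow> 'd \<Rightarrow> int" and k :: "real \<Rightarrow> 'n \<Rightarrow> int"
    where m: "\<And>\<theta> j. beta a (v \<theta>) $ j = of_int (m \<theta> j)"
      and k: "\<And>\<theta> i. i \<notin> B \<Longrightarrow> v \<theta> $ i = (if i \<in> A then - \<theta> else 0) + of_int (k \<theta> i)"
    by metis
  \<comment> \<open>The real line does not inject into the countable type of pairs of integer tuples.\<close>
  have "\<not> inj (\<lambda>\<theta>. (m \<theta>, k \<theta>))"
    using uncountable_UNIV_real countableI_type countable_image_inj_on countable_subset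
    by (metis subset_UNIV)
  then obtain x y where xy: "x \<noteq> y" "m x = m y" "k x = k y"
    by (auto simp: inj_def)
  define u where "u = (1 / (x - y)) *\<^sub>R (v x - v y)"
  have "beta a (v x) = beta a (v y)"
    by (simp add: vec_eq_iff m xy(2))
  then have "u \<in> ker_lie a"
    by (simp add: ker_lie_def u_def linear_scale [OF linear_beta] linear_diff [OF linear_beta])
  moreover have "u $ i = (if i \<in> A then - 1 else 0)" if "i \<notin> B" for i
  proof -
    have "v x $ i - v y $ i = (if i \<in> A then - 1 else 0) * (x - y)"
      using xy by (simp add: k [OF that])
    then show ?thesis using xy(1) by (simp add: u_def)
  qed
  ultimately show "\<exists>v\<in>ker_lie a. \<forall>i. i \<notin> B \<longrightarrow> v $ i = (if i \<in> A then - 1 else 0)"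
    by blast
qed

section \<open>Fixed points in the variety\<close>

text \<open>
  The set \<open>X\<close> is a single \<open>T^k\<close>-orbit, and the circle permutes orbits, so \<open>X\<close> is preserved as
  soon as the image of one of its points lies in it again. A coordinate with \<open>z\<^sub>i \<noteq> 0\<close> then forces
  \<open>t\<^sub>i = 1\<close>, one with \<open>w\<^sub>i \<noteq> 0\<close> forces \<open>t\<^sub>i\<^sup>-\<^sup>1 = \<tau>\<close>, and one where both vanish says nothing.
\<close>

lemma circle_act_eq_iff:
  fixes a :: "'n::finite \<Rightarrow> int ^ 'd::finite"
  assumes X: "X \<in> hypertoric a \<alpha>" "(z, w) \<in> X"
    and A: "\<And>i. i \<in> A \<Longrightarrow> z $ i = 0" "\<And>i. i \<notin> A \<Longrightarrow> w $ i = 0"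
    and \<tau>: "cmod \<tau> = 1"
  shows "circle_act \<tau> X = X \<longleftrightarrow>
    (\<exists>t\<in>ker_torus a. \<forall>i. i \<notin> {i. z $ i = 0 \<and> w $ i = 0} \<longrightarrow>
      t $ i = (if i \<in> A then inverse \<tau> else 1))"
proof -
  have cls: "X = orbit_rel a \<alpha> `` {(z, w)}" and lev: "(z, w) \<in> level_set a \<alpha>"
    using class_rep [OF X] by auto
  let ?q = "(z, \<chi> i. \<tau> * w $ i)"
  have "circle_act \<tau> X = X \<longleftrightarrow> ?q \<in> X"
  proof
    assume "circle_act \<tau> X = X"
    with X(2) show "?q \<in> X" unfolding circle_act_def by force
  next
    assume "?q \<in> X"
    then have "X = orbit_rel a \<alpha> `` {?q}" by (rule class_rep [OF X(1)])
    then show "circle_act \<tau> X = X"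
      using circle_act_class [OF lev \<tau>] cls by simp
  qed
  also have "\<dots> \<longleftrightarrow> (\<exists>t\<in>ker_torus a. ?q = torus_act t (z, w))"
    unfolding cls orbit_rel_class [OF lev] by auto
  also have "\<dots> \<longleftrightarrow> (\<exists>t\<in>ker_torus a. \<forall>i. i \<notin> {i. z $ i = 0 \<and> w $ i = 0} \<longrightarrow>
      t $ i = (if i \<in> A then inverse \<tau> else 1))"
  proof (rule bex_cong [OF refl])
    fix t assume "t \<in> ker_torus a"
    then have nz: "t $ i \<noteq> 0" for i by (simp add: ker_torus_def torus_nonzero)
    have "\<tau> \<noteq> 0" using \<tau> by auto
    then have "z $ i = t $ i * z $ i \<and> \<tau> * w $ i = inverse (t $ i) * w $ i \<longleftrightarrow>
        (i \<notin> {i. z $ i = 0 \<and> w $ i = 0} \<longrightarrow> t $ i = (if i \<in> A then inverse \<tau> else 1))" for i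
      using A [of i] nz [of i] by (cases "i \<in> A") (auto simp: field_simps)
    then show "?q = torus_act t (z, w) \<longleftrightarrow> (\<forall>i. i \<notin> {i. z $ i = 0 \<and> w $ i = 0} \<longrightarrow>
        t $ i = (if i \<in> A then inverse \<tau> else 1))"
      unfolding torus_act_def prod.case prod.inject vec_eq_iff vec_lambda_beta
        all_conj_distrib [symmetric]
      by simp
  qed
  finally show ?thesis .
qed

text \<open>
  The torus rescales coordinates by nonzero factors, so one representative decides which
  coordinates vanish on the whole orbit.
\<close>

lemma M_AB_iff_subset_zeros:
  assumes "X \<in> M_A a \<alpha> l A" "(z, w) \<in> X"
  shows "X \<in> M_AB a \<alpha> l A B \<longleftrightarrow> B \<subseteq> {i. z $ i = 0 \<and> w $ i = 0}"
proof -
  have X: "X \<in> hypertoric a \<alpha>" using assms(1) by (simp add: M_A_def)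
  have cls: "X = (\<lambda>t. torus_act t (z, w)) ` ker_torus a"
    using class_rep [OF X assms(2)] orbit_rel_class by metis+
  have "\<forall>(z', w')\<in>X. \<forall>i\<in>B. z' $ i = 0 \<and> w' $ i = 0"
    if "B \<subseteq> {i. z $ i = 0 \<and> w $ i = 0}"
    using that unfolding cls by (auto simp: torus_act_def)
  then show ?thesis
    using assms unfolding M_AB_def by auto
qed

theorem proposition3p2:
  fixes a :: "'n::finite \<Rightarrow> int ^ 'd::finite"
    and \<alpha> :: "real ^ 'n \<Rightarrow> real"
    and l :: "real ^ 'n"
    and A :: "'n set"
  assumes "\<And>i. a i \<noteq> 0"
    and "\<And>i. primitive_vec (a i)"
    and "span (range (\<lambda>i. real_vec (a i))) = UNIV"
    and "iota_dual a l = \<alpha>"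
    and "simple_arrangement a l"
  shows "circle_fixed (M_A a \<alpha> l A) =
    \<Union> {M_AB a \<alpha> l A B | B. (\<Sum>i\<in>A. real_vec (a i)) \<in> span ((\<lambda>j. real_vec (a j)) ` B)}"
    (is "_ = \<Union> {_ | B. ?s \<in> ?S B}")
proof -
  have fixed_iff: "X \<in> circle_fixed (M_A a \<alpha> l A) \<longleftrightarrow> (\<exists>B. X \<in> M_AB a \<alpha> l A B \<and> ?s \<in> ?S B)"
    if X: "X \<in> M_A a \<alpha> l A" for X
  proof -
    have hyp: "X \<in> hypertoric a \<alpha>" using X by (simp add: M_A_def)
    then have "X \<noteq> {}"
      using in_quotient_imp_non_empty [OF equiv_orbit_rel] unfolding hypertoric_def by blast
    then obtain z w where zw: "(z, w) \<in> X" by (metis all_not_in_conv surj_pair)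
    have A: "\<And>i. i \<in> A \<Longrightarrow> z $ i = 0" "\<And>i. i \<notin> A \<Longrightarrow> w $ i = 0"
      using X zw unfolding M_A_iff [OF assms(3,4)] by auto
    let ?Z = "{i. z $ i = 0 \<and> w $ i = 0}"
    have "X \<in> circle_fixed (M_A a \<alpha> l A) \<longleftrightarrow> (\<forall>\<tau>. cmod \<tau> = 1 \<longrightarrow>
        (\<exists>t\<in>ker_torus a. \<forall>i. i \<notin> ?Z \<longrightarrow> t $ i = (if i \<in> A then inverse \<tau> else 1)))"
      unfolding circle_fixed_def using X circle_act_eq_iff [OF hyp zw A] by auto
    also have "\<dots> \<longleftrightarrow> ?s \<in> ?S ?Z"
      unfolding compensating_torus_iff_lie sum_in_span_iff_lie ..
    also have "\<dots> \<longleftrightarrow> (\<exists>B\<subseteq>?Z. ?s \<in> ?S B)"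
      using span_mono image_mono by (metis (no_types, lifting) order_refl subsetD)
    finally show ?thesis
      using M_AB_iff_subset_zeros [OF X zw] by auto
  qed
  have "X \<in> M_A a \<alpha> l A" if "X \<in> circle_fixed (M_A a \<alpha> l A) \<or> X \<in> M_AB a \<alpha> l A B" for X B
    using that by (auto simp: circle_fixed_def M_AB_def)
  with fixed_iff show ?thesis by blast
qed

end
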